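(* The price of stability of financial network games under priority-proportional strategies is $1$ if default costs $\alpha=\beta=0$ apply and firms aim to maximize their total assets. That is, in every such game there is a Nash equilibrium $\mathbf{s}$ with $SW(\mathbf{P}(\mathbf{s}))=OPT$.
   Context: Financial network: firms $v_1,\dots,v_n$; each $v_i$ has external assets $e_i\ge 0$; $v_i$ owes $v_j$ the liability $l_{ij}\ge 0$, with $l_{ii}=0$ (both $l_{ij}>0$ and $l_{ji}>0$ are allowed); $L_i=\sum_j l_{ij}$. Default costs $\alpha,\beta\in[0,1]$: a firm in default can use only an $\alpha$ fraction of its external assets and a $\beta$ fraction of its incoming payments. Priority-proportional strategy: a strategy $s_i$ of $v_i$ is a complete ordering, allowing ties, of its creditors, i.e. an ordered partition of $\{v_j: l_{ij}>0\}$ into priority classes $1,2,\dots$. Write $L_i^{(m)}$ for the total liability of $v_i$ to its $m$-th class, $k_{ij}$ for the index of the class of $v_i$ containing $v_j$, and $\pi'_{ij}=l_{ij}/L_i^{(k_{ij})}$. Clearing payments consistent with a strategy profile $\mathbf{s}=(s_1,\dots,s_n)$: a matrix $\mathbf{P}=(p_{ij})$ with $p_{ii}=0$, $0\le p_{ij}\le l_{ij}$ and, writing $p_i=\sum_j p_{ij}$, for every $i$: $p_i=L_i$ if $L_i\le e_i+\sum_j p_{ji}$ (solvent), and $p_i=\alpha e_i+\beta\sum_j p_{ji}$ otherwise (in default); moreover for every creditor $v_j$ of $v_i$, $$p_{ij}=\min\Big\{\max\Big\{\Big(p_i-\sum_{m=1}^{k_{ij}-1}L_i^{(m)}\Big)\pi'_{ij},\,0\Big\},\,l_{ij}\Big\},$$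 and $p_{ij}=0$ if $l_{ij}=0$. Clearing payments are proper if every firm with a positive outgoing payment is reachable, by a (possibly trivial) directed path of edges $(v_i,v_j)$ with $p_{ij}>0$, from some firm with positive external assets. Only proper clearing payments are considered. For every profile $\mathbf{s}$ there are maximal ones, denoted $\mathbf{P}(\mathbf{s})$, which are entrywise at least as large as all other proper clearing payments consistent with $\mathbf{s}$. Total assets: $a_i(\mathbf{P})=e_i+\sum_j p_{ji}$. The utility of $v_i$ under $\mathbf{s}$ is $a_i(\mathbf{P}(\mathbf{s}))$. A profile is a (pure) Nash equilibrium if no firm can strictly increase its utility by unilaterally changing its priority-proportional strategy. Social welfare: $SW(\mathbf{P})=\sum_i a_i(\mathbf{P})$; $OPT$ is the maximum of $SW(\mathbf{P}(\mathbf{s}))$ over all strategy profiles. The price of stability of an instance is the minimum of $OPT/SW(\mathbf{P}(\mathbf{s}))$ over Nash equilibria $\mathbf{s}$ (with $0/0=1$); that of a class of games is the supremum over its instances. *)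

theory Defs
  imports Complex_Main "HOL-Library.Disjoint_Sets" "HOL-Library.FuncSet"
    "HOL-Library.Extended_Real"
begin

record financial_network =
  num_firms :: nat
  ext_assets :: "nat \<Rightarrow> real"
  liability :: "nat \<Rightarrow> nat \<Rightarrow> real"
  alpha :: real
  beta :: real

definition firms :: "financial_network \<Rightarrow> nat set" where
  "firms N = {1..num_firms N}"

definition is_network :: "financial_network \<Rightarrow> bool" where
  "is_network N \<longleftrightarrow>
     num_firms N \<ge> 1 \<and>
     (\<forall>i\<in>firms N. ext_assets N i \<ge> 0) \<and>
     (\<forall>i\<in>firms N. \<forall>j\<in>firms N. liability N i j \<ge> 0) \<and>
     (\<forall>i\<in>firms N. liability N i i = 0) \<and>
     alpha N \<in> {0..1} \<and> beta N \<in> {0..1}"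

definition total_liability :: "financial_network \<Rightarrow> nat \<Rightarrow> real" where
  "total_liability N i = (\<Sum>j\<in>firms N. liability N i j)"

definition creditors :: "financial_network \<Rightarrow> nat \<Rightarrow> nat set" where
  "creditors N i = {j \<in> firms N. liability N i j > 0}"

(* A strategy is an ordered partition of the creditors, given as the list of its classes;
   class number m (counted from 1) is the list entry at position m - 1. *)
definition strategies :: "financial_network \<Rightarrow> nat \<Rightarrow> nat set list set" where
  "strategies N i = {cs. distinct cs \<and> partition_on (creditors N i) (set cs)}"

definition profiles :: "financial_network \<Rightarrow> (nat \<Rightarrow> nat set list) set" where
  "profiles N = (\<Pi>\<^sub>E i\<in>firms N. strategies N i)"

definition class_index :: "nat set list \<Rightarrow> nat \<Rightarrow> nat" where
  "class_index cs j = (THE m. 1 \<le> m \<and> m \<le> length cs \<and> j \<in> cs ! (m - 1))"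

definition class_liability :: "financial_network \<Rightarrow> nat \<Rightarrow> nat set list \<Rightarrow> nat \<Rightarrow> real" where
  "class_liability N i cs m = (\<Sum>j\<in>cs ! (m - 1). liability N i j)"

definition rel_liability :: "financial_network \<Rightarrow> nat \<Rightarrow> nat set list \<Rightarrow> nat \<Rightarrow> real" where
  "rel_liability N i cs j = liability N i j / class_liability N i cs (class_index cs j)"

definition outgoing :: "financial_network \<Rightarrow> (nat \<Rightarrow> nat \<Rightarrow> real) \<Rightarrow> nat \<Rightarrow> real" where
  "outgoing N P i = (\<Sum>j\<in>firms N. P i j)"

definition incoming :: "financial_network \<Rightarrow> (nat \<Rightarrow> nat \<Rightarrow> real) \<Rightarrow> nat \<Rightarrow> real" where
  "incoming N P i = (\<Sum>j\<in>firms N. P j i)"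

definition total_assets :: "financial_network \<Rightarrow> (nat \<Rightarrow> nat \<Rightarrow> real) \<Rightarrow> nat \<Rightarrow> real" where
  "total_assets N P i = ext_assets N i + incoming N P i"

(* Payment matrices are functions on all of nat; the first condition fixes the entries outside
   the index range to 0, so that a matrix is determined by its entries between firms. *)
definition clearing_payments ::
  "financial_network \<Rightarrow> (nat \<Rightarrow> nat set list) \<Rightarrow> (nat \<Rightarrow> nat \<Rightarrow> real) \<Rightarrow> bool" where
  "clearing_payments N s P \<longleftrightarrow>
     (\<forall>i j. i \<notin> firms N \<or> j \<notin> firms N \<longrightarrow> P i j = 0) \<and>
     (\<forall>i\<in>firms N. P i i = 0) \<and>
     (\<forall>i\<in>firms N. \<forall>j\<in>firms N. 0 \<le> P i j \<and> P i j \<le> liability N i j) \<and>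
     (\<forall>i\<in>firms N.
        outgoing N P i =
          (if total_liability N i \<le> ext_assets N i + incoming N P i
           then total_liability N i
           else alpha N * ext_assets N i + beta N * incoming N P i)) \<and>
     (\<forall>i\<in>firms N. \<forall>j\<in>creditors N i.
        P i j =
          min (max ((outgoing N P i
                      - (\<Sum>m\<in>{1..<class_index (s i) j}. class_liability N i (s i) m))
                    * rel_liability N i (s i) j) 0)
              (liability N i j)) \<and>
     (\<forall>i\<in>firms N. \<forall>j\<in>firms N. liability N i j = 0 \<longrightarrow> P i j = 0)"

definition payment_edges :: "financial_network \<Rightarrow> (nat \<Rightarrow> nat \<Rightarrow> real) \<Rightarrow> (nat \<times> nat) set" where
  "payment_edges N P = {(i, j). i \<in> firms N \<and> j \<in> firms N \<and> P i j > 0}"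

definition proper :: "financial_network \<Rightarrow> (nat \<Rightarrow> nat \<Rightarrow> real) \<Rightarrow> bool" where
  "proper N P \<longleftrightarrow>
     (\<forall>i\<in>firms N. outgoing N P i > 0 \<longrightarrow>
        (\<exists>k\<in>firms N. ext_assets N k > 0 \<and> (k, i) \<in> (payment_edges N P)\<^sup>*))"

definition maximal_clearing ::
  "financial_network \<Rightarrow> (nat \<Rightarrow> nat set list) \<Rightarrow> (nat \<Rightarrow> nat \<Rightarrow> real) \<Rightarrow> bool" where
  "maximal_clearing N s P \<longleftrightarrow>
     clearing_payments N s P \<and> proper N P \<and>
     (\<forall>Q. clearing_payments N s Q \<and> proper N Q \<longrightarrow>
        (\<forall>i\<in>firms N. \<forall>j\<in>firms N. Q i j \<le> P i j))"

definition payments ::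
  "financial_network \<Rightarrow> (nat \<Rightarrow> nat set list) \<Rightarrow> nat \<Rightarrow> nat \<Rightarrow> real" where
  "payments N s = (THE P. maximal_clearing N s P)"

definition utility :: "financial_network \<Rightarrow> (nat \<Rightarrow> nat set list) \<Rightarrow> nat \<Rightarrow> real" where
  "utility N s i = total_assets N (payments N s) i"

definition nash_equilibrium :: "financial_network \<Rightarrow> (nat \<Rightarrow> nat set list) \<Rightarrow> bool" where
  "nash_equilibrium N s \<longleftrightarrow>
     s \<in> profiles N \<and>
     (\<forall>i\<in>firms N. \<forall>t\<in>strategies N i. \<not> utility N (s(i := t)) i > utility N s i)"

definition social_welfare :: "financial_network \<Rightarrow> (nat \<Rightarrow> nat \<Rightarrow> real) \<Rightarrow> real" where
  "social_welfare N P = (\<Sum>i\<in>firms N. total_assets N P i)"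

definition opt_welfare :: "financial_network \<Rightarrow> real" where
  "opt_welfare N = Max ((\<lambda>s. social_welfare N (payments N s)) ` profiles N)"

(* In ereal, 0 / 0 = 0 and x / 0 = \<infinity> for x > 0; only the former needs overriding. *)
definition welfare_ratio :: "real \<Rightarrow> real \<Rightarrow> ereal" where
  "welfare_ratio a b = (if a = 0 \<and> b = 0 then 1 else ereal a / ereal b)"

(* There are only finitely many profiles, so the infimum is a minimum whenever an equilibrium
   exists; an instance without pure equilibria gets the value \<infinity>. *)
definition price_of_stability :: "financial_network \<Rightarrow> ereal" where
  "price_of_stability N =
     (INF s\<in>{s. nash_equilibrium N s}.
        welfare_ratio (opt_welfare N) (social_welfare N (payments N s)))"

definition class_price_of_stability :: "financial_network set \<Rightarrow> ereal" where
  "class_price_of_stability C = (SUP N\<in>C. price_of_stability N)"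

end

theory Submission
  imports Defs
begin

text \<open>
  With \<open>\<alpha> = \<beta> = 0\<close> a defaulting firm pays nothing and a solvent firm pays every creditor in full.
  Either way the order of the creditors is irrelevant, so all strategy profiles admit the same
  clearing payments, all utilities are constant, and every profile is an optimal equilibrium.
\<close>

lemma finite_firms [simp]: "finite (firms N)"
  by (simp add: firms_def)

text \<open>This makes the \<open>THE\<close> in \<open>class_index\<close> well-defined: the
  classes cover the creditors, so some position holds \<open>j\<close>; disjointness of the classes
  and distinctness of the list leave only one.\<close>

lemma class_index:
  assumes "cs \<in> strategies N i" "j \<in> creditors N i"
  shows "1 \<le> class_index cs j \<and> class_index cs j \<le> length cs \<and> j \<in> cs ! (class_index cs j - 1)"
proof -
  have dist: "distinct cs" and part: "partition_on (creditors N i) (set cs)"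
    using assms(1) by (auto simp: strategies_def)
  obtain n where n: "n < length cs" "j \<in> cs ! n"
    using assms(2) partition_onD1[OF part] by (metis UnionE in_set_conv_nth)
  have uniq: "m = n" if "m < length cs" "j \<in> cs ! m" for m
    using that n dist disjointD[OF partition_onD2[OF part], of "cs ! m" "cs ! n"]
    by (metis disjoint_iff nth_eq_iff_index_eq nth_mem)
  show ?thesis
    unfolding class_index_def
  \<comment> \<open>Classes are numbered from 1, list positions from 0.\<close>
  proof (rule theI[of _ "Suc n"])
    show "1 \<le> Suc n \<and> Suc n \<le> length cs \<and> j \<in> cs ! (Suc n - 1)"
      using n by simp
    show "m = Suc n" if "1 \<le> m \<and> m \<le> length cs \<and> j \<in> cs ! (m - 1)" for m
    proof -
      have "m - 1 < length cs"
        using that by linarith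
      then have "m - 1 = n"
        using uniq that by blast
      then show ?thesis
        using that by linarith
    qed
  qed
qed

context
  fixes N i cs
  assumes net: "is_network N" and i: "i \<in> firms N" and cs: "cs \<in> strategies N i"
begin

lemma class_subset_creditors:
  assumes "1 \<le> m" "m \<le> length cs"
  shows "cs ! (m - 1) \<subseteq> creditors N i"
proof -
  have "cs ! (m - 1) \<in> set cs"
    using assms by simp
  then show ?thesis
    using cs partition_onD1 by (fastforce simp: strategies_def)
qed

lemma class_liability_nonneg:
  assumes "1 \<le> m" "m \<le> length cs"
  shows "0 \<le> class_liability N i cs m"
  unfolding class_liability_def using class_subset_creditors[OF assms]
  by (intro sum_nonneg) (force simp: creditors_def)

text \<open>The first \<open>k\<close> classes are pairwise disjoint sets of firms, so their
  liabilities add up to a sum over one subset of \<open>firms N\<close>, and the remaining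
  liabilities are nonnegative.\<close>

lemma sum_class_liability_le:
  assumes "k \<le> length cs"
  shows "(\<Sum>m\<in>{1..k}. class_liability N i cs m) \<le> total_liability N i"
proof -
  have sub: "cs ! (m - 1) \<subseteq> firms N" if "m \<in> {1..k}" for m
    using class_subset_creditors[of m] that assms by (auto simp: creditors_def)
  have disj: "cs ! (m - 1) \<inter> cs ! (m' - 1) = {}"
    if "m \<in> {1..k}" "m' \<in> {1..k}" "m \<noteq> m'" for m m'
  proof (rule disjointD)
    show "disjoint (set cs)"
      using cs by (simp add: strategies_def partition_on_def)
    \<comment> \<open>\<open>disjoint\<close> separates only different members of
      \<open>set cs\<close>; \<open>distinct cs\<close> ensures that different positions hold
      different members.\<close>
    show "cs ! (m - 1) \<noteq> cs ! (m' - 1)"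
      using cs that assms by (auto simp: strategies_def nth_eq_iff_index_eq)
  qed (use that assms in auto)
  have "(\<Sum>m\<in>{1..k}. class_liability N i cs m)
      = (\<Sum>j\<in>(\<Union>m\<in>{1..k}. cs ! (m - 1)). liability N i j)"
    unfolding class_liability_def
  proof (rule sum.UNION_disjoint[symmetric])
    show "\<forall>m\<in>{1..k}. finite (cs ! (m - 1))"
      using sub finite_subset[OF _ finite_firms] by blast
    show "\<forall>m\<in>{1..k}. \<forall>m'\<in>{1..k}. m \<noteq> m' \<longrightarrow> cs ! (m - 1) \<inter> cs ! (m' - 1) = {}"
      using disj by blast
  qed simp
  also have "\<dots> \<le> total_liability N i"
    unfolding total_liability_def
  proof (rule sum_mono2)
    show "(\<Union>m\<in>{1..k}. cs ! (m - 1)) \<subseteq> firms N"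
      using sub by blast
  qed (use net i in \<open>auto simp: is_network_def\<close>)
  finally show ?thesis .
qed

context
  fixes j
  assumes j: "j \<in> creditors N i"
begin

text \<open>One summand of a nonnegative sum; it makes the denominator of
  \<open>rel_liability\<close> positive.\<close>

lemma liability_le_class_liability:
  "liability N i j \<le> class_liability N i cs (class_index cs j)"
proof -
  have ci: "1 \<le> class_index cs j" "class_index cs j \<le> length cs" "j \<in> cs ! (class_index cs j - 1)"
    using class_index[OF cs j] by auto
  have "cs ! (class_index cs j - 1) \<subseteq> creditors N i"
    using class_subset_creditors ci by blast
  then show ?thesis
    unfolding class_liability_def
    using ci by (intro member_le_sum)
      (force simp: creditors_def intro: finite_subset[OF _ finite_firms])+
qed

text \<open>Once the classes before that of \<open>j\<close> are served, at least the whole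
  liability to its class is left, so the proportional share reaches \<open>liability N i j\<close>
  and the \<open>min\<close> caps it there.\<close>

lemma priority_payment_full:
  "min (max ((total_liability N i
               - (\<Sum>m\<in>{1..<class_index cs j}. class_liability N i cs m))
             * rel_liability N i cs j) 0) (liability N i j) = liability N i j"
proof -
  let ?k = "class_index cs j"
  let ?C = "class_liability N i cs ?k"
  let ?R = "total_liability N i - (\<Sum>m\<in>{1..<?k}. class_liability N i cs m)"
  have k: "1 \<le> ?k" "?k \<le> length cs"
    using class_index[OF cs j] by auto
  have l: "0 < liability N i j"
    using j by (simp add: creditors_def)
  then have C: "0 < ?C"
    using liability_le_class_liability by linarith
  \<comment> \<open>Splitting off class \<open>?k\<close> turns the bound on the first
    \<open>?k\<close> classes into a bound on what is left for it.\<close>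
  have "{1..?k} = insert ?k {1..<?k}"
    using k by auto
  then have "?C \<le> ?R"
    using sum_class_liability_le[OF k(2)] by simp
  then have "?C * (liability N i j / ?C) \<le> ?R * (liability N i j / ?C)"
    using l C by (intro mult_right_mono) auto
  then show ?thesis
    using C by (simp add: rel_liability_def)
qed

text \<open>The difference is nonpositive and the proportion nonnegative, so the \<open>max\<close>
  gives 0, which is below the liability. The form \<open>0 - ...\<close> is the clearing formula at
  outgoing payment 0.\<close>

lemma priority_payment_zero:
  "min (max ((0 - (\<Sum>m\<in>{1..<class_index cs j}. class_liability N i cs m))
             * rel_liability N i cs j) 0) (liability N i j) = 0"
proof -
  have k: "class_index cs j \<le> length cs"
    using class_index[OF cs j] by auto
  have l: "0 < liability N i j"
    using j by (simp add: creditors_def)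
  have "0 \<le> rel_liability N i cs j"
    using l liability_le_class_liability by (simp add: rel_liability_def)
  moreover have "0 \<le> (\<Sum>m\<in>{1..<class_index cs j}. class_liability N i cs m)"
    using k by (intro sum_nonneg class_liability_nonneg) auto
  ultimately show ?thesis
    using l by simp
qed

end

end

text \<open>Outgoing payments are now either the total liability or 0, the two values at which the
  priority formula was evaluated. The point is that \<open>s\<close> no longer occurs on the
  right.\<close>

lemma clearing_payments_iff:
  assumes net: "is_network N" and cost: "alpha N = 0" "beta N = 0" and s: "s \<in> profiles N"
  shows "clearing_payments N s P \<longleftrightarrow>
     (\<forall>i j. i \<notin> firms N \<or> j \<notin> firms N \<longrightarrow> P i j = 0) \<and>
     (\<forall>i\<in>firms N. P i i = 0) \<and>
     (\<forall>i\<in>firms N. \<forall>j\<in>firms N. 0 \<le> P i j \<and> P i j \<le> liability N i j) \<and>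
     (\<forall>i\<in>firms N. outgoing N P i =
        (if total_liability N i \<le> ext_assets N i + incoming N P i
         then total_liability N i else 0)) \<and>
     (\<forall>i\<in>firms N. \<forall>j\<in>creditors N i. P i j =
        (if total_liability N i \<le> ext_assets N i + incoming N P i
         then liability N i j else 0)) \<and>
     (\<forall>i\<in>firms N. \<forall>j\<in>firms N. liability N i j = 0 \<longrightarrow> P i j = 0)"
proof -
  have eq: "min (max ((outgoing N P i
                 - (\<Sum>m\<in>{1..<class_index (s i) j}. class_liability N i (s i) m))
               * rel_liability N i (s i) j) 0) (liability N i j)
      = (if total_liability N i \<le> ext_assets N i + incoming N P i then liability N i j else 0)"
    if "i \<in> firms N" "j \<in> creditors N i"
      "outgoing N P i =
        (if total_liability N i \<le> ext_assets N i + incoming N P i then total_liability N i else 0)"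
    for i j
  proof -
    have "s i \<in> strategies N i"
      using s that(1) by (auto simp: profiles_def)
    then show ?thesis
      using priority_payment_full[OF net that(1) _ that(2)]
        priority_payment_zero[OF net that(1) _ that(2)]
      by (simp add: that(3))
  qed
  show ?thesis
    unfolding clearing_payments_def cost mult_zero_left add_0_right
    \<comment> \<open>\<open>conj_cong\<close> provides the earlier conjuncts as assumptions, among
      them the one on \<open>outgoing\<close> that \<open>eq\<close> requires.\<close>
    by (intro conj_cong ball_cong refl) (subst eq, assumption, assumption, erule (1) bspec, rule refl)
qed

text \<open>A profile enters \<open>payments\<close> only through the predicate
  \<open>clearing_payments N s\<close>.\<close>

lemma payments_independent:
  assumes "is_network N" "alpha N = 0" "beta N = 0" "s \<in> profiles N" "t \<in> profiles N"
  shows "payments N s = payments N t"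
proof -
  have "clearing_payments N s = clearing_payments N t"
    using assms by (intro ext) (simp add: clearing_payments_iff)
  then show ?thesis
    by (simp add: payments_def maximal_clearing_def)
qed

lemma strategies_nonempty: "strategies N i \<noteq> {}"
proof -
  \<comment> \<open>All creditors tie in one class; without creditors the list is empty, as a
    partition has no empty class.\<close>
  have "(if creditors N i = {} then [] else [creditors N i]) \<in> strategies N i"
    by (auto simp: strategies_def partition_on_def)
  then show ?thesis by blast
qed

lemma profiles_nonempty: "profiles N \<noteq> {}"
  by (simp add: profiles_def PiE_eq_empty_iff strategies_nonempty)

lemma profiles_update:
  assumes "s \<in> profiles N" "i \<in> firms N" "t \<in> strategies N i"
  shows "s(i := t) \<in> profiles N"
  using assms by (auto simp: profiles_def PiE_iff extensional_def)

lemma profile_nash_equilibrium: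
  assumes "is_network N" "alpha N = 0" "beta N = 0" "s \<in> profiles N"
  shows "nash_equilibrium N s"
  using assms payments_independent[OF assms(1-3) profiles_update[OF assms(4)] assms(4)]
  by (simp add: nash_equilibrium_def utility_def)

lemma profile_optimal:
  assumes "is_network N" "alpha N = 0" "beta N = 0" "s \<in> profiles N"
  shows "social_welfare N (payments N s) = opt_welfare N"
proof -
  have "(\<lambda>t. social_welfare N (payments N t)) ` profiles N = {social_welfare N (payments N s)}"
    using assms(4) by (force dest: payments_independent[OF assms(1-3) _ assms(4)])
  then show ?thesis
    by (simp add: opt_welfare_def)
qed

text \<open>The case \<open>a = 0\<close> rests on the convention 0/0 = 1.\<close>

lemma welfare_ratio_self: "welfare_ratio a a = 1"
  by (simp add: welfare_ratio_def one_ereal_def)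

lemma price_of_stability_eq_1:
  assumes "is_network N" "alpha N = 0" "beta N = 0"
  shows "price_of_stability N = 1"
proof -
  have eqs: "{s. nash_equilibrium N s} = profiles N"
    using profile_nash_equilibrium[OF assms] by (auto simp: nash_equilibrium_def)
  show ?thesis
    \<comment> \<open>The infimum of the constant 1 is 1 because some profile exists; over the empty
      set it would be \<infinity>.\<close>
    unfolding price_of_stability_def eqs
    by (simp add: profile_optimal[OF assms] welfare_ratio_self profiles_nonempty)
qed

theorem theorem6:
  "class_price_of_stability {N. is_network N \<and> alpha N = 0 \<and> beta N = 0} = 1 \<and>
   (\<forall>N. is_network N \<and> alpha N = 0 \<and> beta N = 0 \<longrightarrow>
      (\<exists>s. nash_equilibrium N s \<and>
           social_welfare N (payments N s) = opt_welfare N))"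
proof
  let ?C = "{N. is_network N \<and> alpha N = 0 \<and> beta N = 0}"
  \<comment> \<open>A single firm without assets or debts shows that the class is nonempty; an empty
    supremum in \<open>ereal\<close> would be -\<infinity>.\<close>
  have "\<lparr>num_firms = 1, ext_assets = \<lambda>_. 0, liability = \<lambda>_ _. 0, alpha = 0, beta = 0\<rparr> \<in> ?C"
    by (simp add: is_network_def)
  then have "?C \<noteq> {}"
    by blast
  moreover have "class_price_of_stability ?C = (SUP N\<in>?C. 1)"
    unfolding class_price_of_stability_def by (intro SUP_cong) (auto simp: price_of_stability_eq_1)
  ultimately show "class_price_of_stability ?C = 1"
    by simp
next
  show "\<forall>N. is_network N \<and> alpha N = 0 \<and> beta N = 0 \<longrightarrow>
      (\<exists>s. nash_equilibrium N s \<and> social_welfare N (payments N s) = opt_welfare N)"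
    using profile_nash_equilibrium profile_optimal profiles_nonempty by blast
qed

end
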